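(* Let $\mathcal H$ be a real Hilbert space, let $\mu\in\,]0,\infty[$, let $n\ge 1$ be an integer, $I=\{1,\dots,n\}$, and let $\lambda_i>0$ ($i\in I$) satisfy $\sum_{i\in I}\lambda_i=1$. For each $i\in I$ let $A_i:\mathcal H\rightrightarrows\mathcal H$ be maximally monotone and monotone with modulus $\phi_i$, where $\phi_i$ is lower semicontinuous and convex. Write $\mathbf A=(A_1,\dots,A_n)$, $\boldsymbol\phi=(\phi_1,\dots,\phi_n)$, $\boldsymbol\lambda=(\lambda_1,\dots,\lambda_n)$. Then $\mathcal R_\mu(\mathbf A,\boldsymbol\lambda)$ is monotone with modulus $\phi=p_{\mu/2}(\boldsymbol\phi,\boldsymbol\lambda)$, and $\phi$ is lower semicontinuous and convex. In particular, if there exists $i_0\in I$ such that $A_{i_0}$ is $\phi_{i_0}$-uniformly monotone, then $\mathcal R_\mu(\mathbf A,\boldsymbol\lambda)$ is $\phi$-uniformly monotone.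
   Context: A mapping $A:\mathcal H\rightrightarrows\mathcal H$ is monotone with modulus $\phi:[0,\infty[\,\to[0,\infty]$ if $\phi(\|x-y\|)\le\langle u-v,x-y\rangle$ for all $(x,u),(y,v)$ in the graph of $A$. It is $\phi$-uniformly monotone if it is monotone with modulus $\phi$ and $\phi(t)=0\Leftrightarrow t=0$. A modulus $\phi:[0,\infty[\,\to[0,\infty]$ is identified with its symmetric extension $\phi(|\cdot|)$ to $\mathbb R$. The $\boldsymbol\lambda$-weighted resolvent average of $\mathbf A$ with parameter $\mu$ is $$\mathcal R_\mu(\mathbf A,\boldsymbol\lambda)=\Big(\sum_{i\in I}\lambda_i(A_i+\mu^{-1}\mathrm{Id})^{-1}\Big)^{-1}-\mu^{-1}\mathrm{Id},$$ where inverses are set-valued inverses ($x\in A^{-1}u\Leftrightarrow u\in Ax$), sums and multiples are pointwise Minkowski operations, and $\mathrm{Id}$ is the identity. For a parameter $\nu\in\,]0,\infty[$ and functions $f_1,\dots,f_n$ on a real Hilbert space $X$ with values in $]-\infty,+\infty]$, the $\boldsymbol\lambda$-weighted proximal average with parameter $\nu$ is $$p_\nu(\mathbf f,\boldsymbol\lambda)(x)=\frac1\nu\Big(-\frac12\|x\|^2+\inf_{\sum_{i\in I}x_i=x}\sum_{i\in I}\lambda_i\big(\nu f_i(x_i/\lambda_i)+\tfrac12\|x_i/\lambda_i\|^2\big)\Big),\quad x\in X.$$ Here it is applied with $X=\mathbb R$ to the symmetric extensions of the $\phi_i$. *)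

theory Defs
  imports "HOL-Analysis.Analysis" "HOL-Library.Set_Algebras"
begin

section \<open>Set-valued operators\<close>

type_synonym 'a sv_op = "'a \<Rightarrow> 'a set"

definition sv_inverse :: "'a sv_op \<Rightarrow> 'a sv_op" where
  "sv_inverse A u = {x. u \<in> A x}"

definition sv_id :: "'a sv_op" where
  "sv_id x = {x}"

text \<open>Addition of sets is the Minkowski sum of \<^theory>\<open>HOL-Library.Set_Algebras\<close>.\<close>

definition sv_add :: "'a::real_vector sv_op \<Rightarrow> 'a sv_op \<Rightarrow> 'a sv_op" where
  "sv_add A B x = A x + B x"

definition sv_scale :: "real \<Rightarrow> 'a::real_vector sv_op \<Rightarrow> 'a sv_op" where
  "sv_scale c A x = (\<lambda>u. c *\<^sub>R u) ` A x"

definition sv_sum :: "(nat \<Rightarrow> 'a::real_vector sv_op) \<Rightarrow> nat set \<Rightarrow> 'a sv_op" where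
  "sv_sum A I x = (\<Sum>i\<in>I. A i x)"

definition monotone_op :: "'a::real_inner sv_op \<Rightarrow> bool" where
  "monotone_op A \<longleftrightarrow> (\<forall>x y. \<forall>u\<in>A x. \<forall>v\<in>A y. 0 \<le> (u - v) \<bullet> (x - y))"

definition maximally_monotone :: "'a::real_inner sv_op \<Rightarrow> bool" where
  "maximally_monotone A \<longleftrightarrow>
     monotone_op A \<and> (\<forall>B. monotone_op B \<and> (\<forall>x. A x \<subseteq> B x) \<longrightarrow> B = A)"

section \<open>Extended-real-valued functions\<close>

definition lsc_on :: "'a::topological_space set \<Rightarrow> ('a \<Rightarrow> ereal) \<Rightarrow> bool" where
  "lsc_on S f \<longleftrightarrow> (\<forall>x\<in>S. f x \<le> Liminf (at x within S) f)"

text \<open>The library's \<open>convex_on\<close> and \<open>epigraph\<close> are restricted to real-valued functions.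
  Convexity of the epigraph avoids the convention for \<open>\<infinity> - \<infinity>\<close>.\<close>

definition ereal_convex_on :: "'a::real_vector set \<Rightarrow> ('a \<Rightarrow> ereal) \<Rightarrow> bool" where
  "ereal_convex_on S f \<longleftrightarrow> convex {(x, r). x \<in> S \<and> f x \<le> ereal r}"

section \<open>Monotonicity with a modulus\<close>

text \<open>A modulus is a function from \<open>[0,\<infinity>[\<close> to \<open>[0,\<infinity>]\<close>. It is represented by a function on
  all reals whose values on negative arguments are irrelevant; \<open>symmetric_extension\<close> gives the
  even function on the reals with which the modulus is identified.\<close>

definition modulus :: "(real \<Rightarrow> ereal) \<Rightarrow> bool" where
  "modulus \<phi> \<longleftrightarrow> (\<forall>t\<ge>0. 0 \<le> \<phi> t)"

definition symmetric_extension :: "(real \<Rightarrow> ereal) \<Rightarrow> real \<Rightarrow> ereal" where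
  "symmetric_extension \<phi> t = \<phi> \<bar>t\<bar>"

definition monotone_with_modulus :: "'a::real_inner sv_op \<Rightarrow> (real \<Rightarrow> ereal) \<Rightarrow> bool" where
  "monotone_with_modulus A \<phi> \<longleftrightarrow>
     modulus \<phi> \<and> (\<forall>x y. \<forall>u\<in>A x. \<forall>v\<in>A y. \<phi> (norm (x - y)) \<le> ereal ((u - v) \<bullet> (x - y)))"

definition uniformly_monotone :: "'a::real_inner sv_op \<Rightarrow> (real \<Rightarrow> ereal) \<Rightarrow> bool" where
  "uniformly_monotone A \<phi> \<longleftrightarrow> monotone_with_modulus A \<phi> \<and> (\<forall>t\<ge>0. \<phi> t = 0 \<longleftrightarrow> t = 0)"

section \<open>Resolvent average and proximal average\<close>

definition resolvent_average ::
  "nat \<Rightarrow> real \<Rightarrow> (nat \<Rightarrow> 'a::real_vector sv_op) \<Rightarrow> (nat \<Rightarrow> real) \<Rightarrow> 'a sv_op" where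
  "resolvent_average n \<mu> A w =
     sv_add
       (sv_inverse
         (sv_sum (\<lambda>i. sv_scale (w i) (sv_inverse (sv_add (A i) (sv_scale (inverse \<mu>) sv_id)))) {1..n}))
       (sv_scale (- inverse \<mu>) sv_id)"

text \<open>The functions \<open>f i\<close> are meant to take values in \<open>]-\<infinity>,+\<infinity>]\<close>, so that no sum below
  involves both infinities. The infimum ranges over functions on all naturals; only their values
  on \<open>{1..n}\<close> matter.\<close>

definition proximal_average ::
  "nat \<Rightarrow> real \<Rightarrow> (nat \<Rightarrow> 'a::real_normed_vector \<Rightarrow> ereal) \<Rightarrow> (nat \<Rightarrow> real) \<Rightarrow> 'a \<Rightarrow> ereal" where
  "proximal_average n \<nu> f w x =
     ereal (1 / \<nu>) *
       (ereal (- (1/2) * (norm x)\<^sup>2) +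
        (INF y \<in> {y :: nat \<Rightarrow> 'a. (\<Sum>i\<in>{1..n}. y i) = x}.
           \<Sum>i\<in>{1..n}. ereal (w i) *
             (ereal \<nu> * f i (y i /\<^sub>R w i) + ereal (1/2 * (norm (y i /\<^sub>R w i))\<^sup>2))))"

end

theory Submission
  imports Defs
begin

text \<open>
  Since \<open>\<Sum>i. w i = 1\<close>, the proximal average of functions \<open>f i\<close> is
  \<open>x \<mapsto> inf {\<Sum>i. w i * (f i (z i) + \<parallel>z i - x\<parallel>\<^sup>2 / (2 \<nu>)) | z. \<Sum>i. w i *\<^sub>R z i = x}\<close>: the quadratic
  terms combine to the variance of the points \<open>z i\<close> around their barycentre \<open>x\<close>. This form is
  jointly convex in \<open>x\<close> and \<open>z\<close>, and for nonnegative \<open>f i\<close> it is coercive in \<open>z\<close>. If the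
  epigraphs of the \<open>f i\<close> are closed, a compactness argument shows that the infimum is attained and
  that the epigraph of the average is closed (\<open>proximal_average_le_iff\<close>, \<open>closed_averaged_epigraph\<close>);
  if they are convex, so is the epigraph of the average. By attainment, the average vanishes at
  \<open>x\<close> only if every \<open>f i\<close> vanishes at \<open>x\<close>, because then the variance is zero and every \<open>z i\<close>
  equals \<open>x\<close>. This is what carries uniform monotonicity of a single \<open>A i\<close> over to the average.

  The symmetric extension of a convex modulus \<open>\<phi>\<close> is convex because \<open>\<phi> 0 = 0\<close>. This equation
  holds since the graph of a maximally monotone operator is nonempty; a convex nonnegative
  function vanishing at \<open>0\<close> is nondecreasing on the half-line.

  For the monotonicity inequality, let \<open>u\<close> and \<open>v\<close> be values of the resolvent average at \<open>x\<close> and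
  \<open>y\<close>. Then \<open>x = \<Sum>i. w i *\<^sub>R p i\<close> with \<open>u + (x - p i) / \<mu> \<in> A i (p i)\<close>, and similarly for \<open>y\<close>, with
  points \<open>q i\<close>. Averaging the modulus inequalities of the \<open>A i\<close> gives, with \<open>d i = \<parallel>p i - q i\<parallel>\<close>,
  \<open>\<Sum>i. w i * \<phi> i (d i) + (\<Sum>i. w i * (d i)\<^sup>2 - \<parallel>x - y\<parallel>\<^sup>2) / \<mu> \<le> \<langle>u - v, x - y\<rangle>\<close>.
  The numbers \<open>d i\<close> average to at least \<open>\<parallel>x - y\<parallel>\<close>; scaling them down to average exactly
  \<open>\<parallel>x - y\<parallel>\<close> only decreases the left-hand side, which then bounds the proximal average.
\<close>

section \<open>Lower semicontinuity and closed epigraphs\<close>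

lemma lsc_on_iff_closed_epigraph:
  fixes f :: "'a::metric_space \<Rightarrow> ereal"
  assumes "closed S"
  shows "lsc_on S f \<longleftrightarrow> closed {(x, r). x \<in> S \<and> f x \<le> ereal r}"
proof
  assume lsc: "lsc_on S f"
  show "closed {(x, r). x \<in> S \<and> f x \<le> ereal r}"
    unfolding closed_sequential_limits
  proof (intro allI impI, elim conjE)
    fix p :: "nat \<Rightarrow> 'a \<times> real" and l
    assume p: "\<forall>k. p k \<in> {(x, r). x \<in> S \<and> f x \<le> ereal r}" and lim: "p \<longlonglongrightarrow> l"
    obtain x r where l: "l = (x, r)" by (cases l)
    have limx: "(\<lambda>k. fst (p k)) \<longlonglongrightarrow> x" and limr: "(\<lambda>k. snd (p k)) \<longlonglongrightarrow> r"
      using tendsto_fst[OF lim] tendsto_snd[OF lim] l by simp_all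
    have pS: "fst (p k) \<in> S" and pf: "f (fst (p k)) \<le> ereal (snd (p k))" for k
      using p[rule_format, of k] by (auto simp: split_beta)
    have xS: "x \<in> S"
      using closed_sequentially[OF assms _ limx] pS by blast
    have "f x \<le> ereal r"
    proof (rule ccontr)
      assume "\<not> f x \<le> ereal r"
      then have "ereal r < f x" by simp
      then obtain s where s: "ereal r < ereal s" "ereal s < f x"
        using ereal_dense2 by blast
      have "ereal s < Liminf (at x within S) f"
        using s(2) lsc xS unfolding lsc_on_def by (meson less_le_trans)
      then have "eventually (\<lambda>y. ereal s < f y) (at x within S)"
        by (rule less_LiminfD)
      then have "eventually (\<lambda>y. y \<in> S \<longrightarrow> ereal s < f y) (nhds x)"
        unfolding eventually_at_filter
        by (rule eventually_mono) (use s(2) in auto)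
      then have "eventually (\<lambda>k. fst (p k) \<in> S \<longrightarrow> ereal s < f (fst (p k))) sequentially"
        using limx by (rule eventually_compose_filterlim)
      moreover have "eventually (\<lambda>k. snd (p k) < s) sequentially"
        using limr s(1) by (simp add: order_tendstoD(2))
      ultimately have "eventually (\<lambda>k. False) sequentially"
      proof eventually_elim
        case (elim k)
        then have "ereal s < ereal (snd (p k))"
          using pS[of k] pf[of k] by (meson less_le_trans)
        with elim show False by simp
      qed
      then show False by simp
    qed
    with xS l show "l \<in> {(x, r). x \<in> S \<and> f x \<le> ereal r}" by simp
  qed
next
  assume cl: "closed {(x, r). x \<in> S \<and> f x \<le> ereal r}" (is "closed ?E")
  show "lsc_on S f"
    unfolding lsc_on_def le_Liminf_iff
  proof (intro ballI allI impI)
    fix x y assume "x \<in> S" "y < f x"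
    then obtain r where r: "y < ereal r" "ereal r < f x"
      using ereal_dense2 by blast
    have "(x, r) \<in> - ?E" using r(2) by auto
    then have "eventually (\<lambda>p. p \<in> - ?E) (nhds (x, r))"
      using cl by (intro eventually_nhds_in_open) auto
    moreover have "filterlim (\<lambda>z. (z, r)) (nhds (x, r)) (nhds x)"
      by (intro tendsto_Pair tendsto_const filterlim_ident)
    ultimately have "eventually (\<lambda>z. (z, r) \<in> - ?E) (nhds x)"
      by (rule eventually_compose_filterlim)
    then show "eventually (\<lambda>z. y < f z) (at x within S)"
      unfolding eventually_at_filter
      by (rule eventually_mono) (use r(1) in auto)
  qed
qed

section \<open>Moduli\<close>

lemma maximally_monotone_nonempty_graph:
  assumes "maximally_monotone A"
  obtains x u where "u \<in> A x"
proof -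
  have "\<exists>x u. u \<in> A x"
  proof (rule ccontr)
    assume "\<nexists>x u. u \<in> A x"
    then have empty: "A x = {}" for x by blast
    \<comment> \<open>The operator whose graph is \<open>{(0, 0)}\<close> would be a proper monotone extension.\<close>
    define B :: "'a sv_op" where "B = (\<lambda>x. if x = 0 then {0} else {})"
    have "monotone_op B" by (simp add: monotone_op_def B_def)
    with assms empty have "B = A" by (simp add: maximally_monotone_def)
    then have "B 0 = {}" using empty by simp
    then show False by (simp add: B_def)
  qed
  then show thesis using that by blast
qed

lemma modulus_at_0:
  assumes "maximally_monotone A" "monotone_with_modulus A \<phi>"
  shows "\<phi> 0 = 0"
proof -
  obtain x u where u: "u \<in> A x"
    using maximally_monotone_nonempty_graph[OF assms(1)] .
  then have "\<phi> (norm (x - x)) \<le> ereal ((u - u) \<bullet> (x - x))"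
    using assms(2) unfolding monotone_with_modulus_def by blast
  moreover have "0 \<le> \<phi> 0"
    using assms(2) by (simp add: monotone_with_modulus_def modulus_def)
  ultimately show ?thesis by (simp add: zero_ereal_def)
qed

lemma convex_modulus_mono:
  assumes "modulus \<phi>" "\<phi> 0 = 0" "ereal_convex_on {0..} \<phi>" "0 \<le> s" "s \<le> t"
  shows "\<phi> s \<le> \<phi> t"
proof (cases "\<phi> t")
  case (real c)
  have c: "0 \<le> c"
    using assms(1,4,5) real unfolding modulus_def by (metis ereal_less_eq(5) order_trans)
  show ?thesis
  proof (cases "t = 0")
    case True
    with assms(4,5) show ?thesis by simp
  next
    case False
    with assms(4,5) have t: "0 < t" by simp
    have "(1 - s / t) *\<^sub>R (0, 0) + (s / t) *\<^sub>R (t, c) \<in> {(x, r). x \<in> {0..} \<and> \<phi> x \<le> ereal r}"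
      using assms(3) t assms(2,4,5) real unfolding ereal_convex_on_def
      by (intro convexD) (auto simp: zero_ereal_def)
    then have "\<phi> s \<le> ereal (s / t * c)" using t by simp
    also have "s / t * c \<le> 1 * c"
      using t assms(5) c by (intro mult_right_mono) auto
    finally show ?thesis using real by simp
  qed
next
  case MInf
  with assms(1,4,5) show ?thesis unfolding modulus_def
    by (metis ereal_infty_less_eq(2) ereal_zero_le_0_iff MInfty_neq_ereal(1) order_trans zero_ereal_def)
qed simp

lemma closed_epigraph_symmetric_extension:
  assumes "lsc_on {0..} \<phi>"
  shows "closed {(t, c). symmetric_extension \<phi> t \<le> ereal c}"
proof -
  have "closed {(t, c). t \<in> {0..} \<and> \<phi> t \<le> ereal c}"
    using assms by (subst lsc_on_iff_closed_epigraph[symmetric]) auto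
  then have "closed ((\<lambda>p. (\<bar>fst p\<bar>, snd p)) -` {(t, c). t \<in> {0..} \<and> \<phi> t \<le> ereal c})"
    by (rule closed_vimage) (intro continuous_intros)
  also have "(\<lambda>p. (\<bar>fst p\<bar>, snd p)) -` {(t, c). t \<in> {0..} \<and> \<phi> t \<le> ereal c}
      = {(t, c). symmetric_extension \<phi> t \<le> ereal c}"
    by (auto simp: symmetric_extension_def)
  finally show ?thesis .
qed

lemma convex_symmetric_extension:
  assumes "modulus \<phi>" "\<phi> 0 = 0" "ereal_convex_on {0..} \<phi>"
  shows "ereal_convex_on UNIV (symmetric_extension \<phi>)"
  unfolding ereal_convex_on_def
proof (rule convexI)
  fix p q :: "real \<times> real" and a b :: real
  assume p: "p \<in> {(x, r). x \<in> UNIV \<and> symmetric_extension \<phi> x \<le> ereal r}"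
    and q: "q \<in> {(x, r). x \<in> UNIV \<and> symmetric_extension \<phi> x \<le> ereal r}"
    and ab: "0 \<le> a" "0 \<le> b" "a + b = 1"
  obtain s c t d where pq: "p = (s, c)" "q = (t, d)" by (cases p, cases q)
  have le: "\<phi> \<bar>s\<bar> \<le> ereal c" "\<phi> \<bar>t\<bar> \<le> ereal d"
    using p q pq by (simp_all add: symmetric_extension_def)
  have "\<bar>a * s + b * t\<bar> \<le> a * \<bar>s\<bar> + b * \<bar>t\<bar>"
    using abs_triangle_ineq[of "a * s" "b * t"] ab by (simp add: abs_mult)
  then have "\<phi> \<bar>a * s + b * t\<bar> \<le> \<phi> (a * \<bar>s\<bar> + b * \<bar>t\<bar>)"
    by (intro convex_modulus_mono[OF assms]) auto
  also have "a *\<^sub>R (\<bar>s\<bar>, c) + b *\<^sub>R (\<bar>t\<bar>, d) \<in> {(x, r). x \<in> {0..} \<and> \<phi> x \<le> ereal r}"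
    using assms(3) le ab unfolding ereal_convex_on_def by (intro convexD) auto
  then have "\<phi> (a * \<bar>s\<bar> + b * \<bar>t\<bar>) \<le> ereal (a * c + b * d)" by simp
  finally show "a *\<^sub>R p + b *\<^sub>R q \<in> {(x, r). x \<in> UNIV \<and> symmetric_extension \<phi> x \<le> ereal r}"
    by (simp add: pq symmetric_extension_def)
qed

section \<open>The epigraph of the proximal average\<close>

lemma weighted_variance_eq:
  fixes z :: "'i \<Rightarrow> 'a::real_inner"
  assumes "(\<Sum>i\<in>I. w i) = 1" "(\<Sum>i\<in>I. w i *\<^sub>R z i) = x"
  shows "(\<Sum>i\<in>I. w i * (norm (z i - x))\<^sup>2) = (\<Sum>i\<in>I. w i * (norm (z i))\<^sup>2) - (norm x)\<^sup>2"
proof -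
  have "(\<Sum>i\<in>I. w i * (norm (z i - x))\<^sup>2)
      = (\<Sum>i\<in>I. w i * (norm (z i))\<^sup>2 - 2 * ((w i *\<^sub>R z i) \<bullet> x) + w i * (norm x)\<^sup>2)"
    by (intro sum.cong refl)
      (simp add: power2_norm_eq_inner inner_diff inner_commute algebra_simps)
  also have "\<dots> = (\<Sum>i\<in>I. w i * (norm (z i))\<^sup>2) - 2 * ((\<Sum>i\<in>I. w i *\<^sub>R z i) \<bullet> x)
      + (\<Sum>i\<in>I. w i) * (norm x)\<^sup>2"
    by (simp add: sum.distrib sum_subtractf sum_distrib_left sum_distrib_right inner_sum_left)
  finally show ?thesis
    using assms by (simp add: power2_norm_eq_inner)
qed

text \<open>The pairs \<open>(x, r)\<close> for which some decomposition \<open>x = \<Sum>i. w i *\<^sub>R z i\<close> has value at most \<open>r\<close>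
  in the variance form of the proximal average. The values \<open>f i (z i)\<close> are replaced by real upper
  bounds \<open>c i\<close>, so that the definition involves real arithmetic and the epigraphs of the \<open>f i\<close> only.\<close>

definition averaged_epigraph ::
  "'i set \<Rightarrow> real \<Rightarrow> ('i \<Rightarrow> 'a::real_normed_vector \<Rightarrow> ereal) \<Rightarrow> ('i \<Rightarrow> real) \<Rightarrow> ('a \<times> real) set" where
  "averaged_epigraph I \<nu> f w = {(x, r). \<exists>z c. (\<forall>i\<in>I. f i (z i) \<le> ereal (c i))
     \<and> (\<Sum>i\<in>I. w i *\<^sub>R z i) = x
     \<and> (\<Sum>i\<in>I. w i * (c i + (norm (z i - x))\<^sup>2 / (2 * \<nu>))) \<le> r}"

lemma averaged_epigraphI:
  assumes "\<And>i. i \<in> I \<Longrightarrow> f i (z i) \<le> ereal (c i)" "(\<Sum>i\<in>I. w i *\<^sub>R z i) = x"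
    and "(\<Sum>i\<in>I. w i * (c i + (norm (z i - x))\<^sup>2 / (2 * \<nu>))) \<le> r"
  shows "(x, r) \<in> averaged_epigraph I \<nu> f w"
  using assms unfolding averaged_epigraph_def by blast

lemma averaged_epigraphE:
  assumes "(x, r) \<in> averaged_epigraph I \<nu> f w"
  obtains z c where "\<And>i. i \<in> I \<Longrightarrow> f i (z i) \<le> ereal (c i)" "(\<Sum>i\<in>I. w i *\<^sub>R z i) = x"
    "(\<Sum>i\<in>I. w i * (c i + (norm (z i - x))\<^sup>2 / (2 * \<nu>))) \<le> r"
  using assms unfolding averaged_epigraph_def by blast

lemma convex_averaged_epigraph:
  fixes f :: "'i \<Rightarrow> 'a::real_normed_vector \<Rightarrow> ereal"
  assumes \<nu>: "0 < \<nu>" and w: "\<And>i. i \<in> I \<Longrightarrow> 0 \<le> w i"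
    and conv: "\<And>i. i \<in> I \<Longrightarrow> ereal_convex_on UNIV (f i)"
  shows "convex (averaged_epigraph I \<nu> f w)"
proof (rule convexI)
  fix P Q and a b :: real
  assume P: "P \<in> averaged_epigraph I \<nu> f w" and Q: "Q \<in> averaged_epigraph I \<nu> f w"
    and ab: "0 \<le> a" "0 \<le> b" "a + b = 1"
  obtain x r y s where PQ: "P = (x, r)" "Q = (y, s)" by (cases P, cases Q)
  obtain z c where z: "\<And>i. i \<in> I \<Longrightarrow> f i (z i) \<le> ereal (c i)" "(\<Sum>i\<in>I. w i *\<^sub>R z i) = x"
      "(\<Sum>i\<in>I. w i * (c i + (norm (z i - x))\<^sup>2 / (2 * \<nu>))) \<le> r"
    using P unfolding PQ(1) by (rule averaged_epigraphE) (rule that)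
  obtain z' c' where z': "\<And>i. i \<in> I \<Longrightarrow> f i (z' i) \<le> ereal (c' i)" "(\<Sum>i\<in>I. w i *\<^sub>R z' i) = y"
      "(\<Sum>i\<in>I. w i * (c' i + (norm (z' i - y))\<^sup>2 / (2 * \<nu>))) \<le> s"
    using Q unfolding PQ(2) by (rule averaged_epigraphE) (rule that)
  define m where "m i = a *\<^sub>R z i + b *\<^sub>R z' i" for i
  define e where "e i = a * c i + b * c' i" for i
  have "f i (m i) \<le> ereal (e i)" if i: "i \<in> I" for i
  proof -
    have "a *\<^sub>R (z i, c i) + b *\<^sub>R (z' i, c' i) \<in> {(x, r). x \<in> UNIV \<and> f i x \<le> ereal r}"
      using conv[OF i] z(1)[OF i] z'(1)[OF i] ab unfolding ereal_convex_on_def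
      by (intro convexD) auto
    then show ?thesis by (simp add: m_def e_def)
  qed
  moreover have "(\<Sum>i\<in>I. w i *\<^sub>R m i) = a *\<^sub>R x + b *\<^sub>R y"
    unfolding m_def z(2)[symmetric] z'(2)[symmetric]
    by (simp add: scaleR_add_right sum.distrib scaleR_sum_right mult.commute)
  moreover have "(\<Sum>i\<in>I. w i * (e i + (norm (m i - (a *\<^sub>R x + b *\<^sub>R y)))\<^sup>2 / (2 * \<nu>))) \<le> a * r + b * s"
  proof -
    have a_eq: "a = 1 - b" using ab by simp
    have sq: "(norm (m i - (a *\<^sub>R x + b *\<^sub>R y)))\<^sup>2
        \<le> a * (norm (z i - x))\<^sup>2 + b * (norm (z' i - y))\<^sup>2" for i
    proof -
      have "m i - (a *\<^sub>R x + b *\<^sub>R y) = a *\<^sub>R (z i - x) + b *\<^sub>R (z' i - y)"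
        by (simp add: m_def algebra_simps)
      then have "norm (m i - (a *\<^sub>R x + b *\<^sub>R y)) \<le> a * norm (z i - x) + b * norm (z' i - y)"
        using norm_triangle_ineq[of "a *\<^sub>R (z i - x)" "b *\<^sub>R (z' i - y)"] ab by simp
      then have "(norm (m i - (a *\<^sub>R x + b *\<^sub>R y)))\<^sup>2 \<le> (a * norm (z i - x) + b * norm (z' i - y))\<^sup>2"
        by (intro power_mono) auto
      also have "\<dots> \<le> a * (norm (z i - x))\<^sup>2 + b * (norm (z' i - y))\<^sup>2"
        using convex_onD[OF convex_power2, of b "norm (z i - x)" "norm (z' i - y)"] ab a_eq
        by simp
      finally show ?thesis .
    qed
    have "(\<Sum>i\<in>I. w i * (e i + (norm (m i - (a *\<^sub>R x + b *\<^sub>R y)))\<^sup>2 / (2 * \<nu>)))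
        \<le> (\<Sum>i\<in>I. w i * (e i + (a * (norm (z i - x))\<^sup>2 + b * (norm (z' i - y))\<^sup>2) / (2 * \<nu>)))"
      using sq \<nu> w by (intro sum_mono mult_left_mono add_left_mono divide_right_mono) auto
    also have "\<dots> = a * (\<Sum>i\<in>I. w i * (c i + (norm (z i - x))\<^sup>2 / (2 * \<nu>)))
        + b * (\<Sum>i\<in>I. w i * (c' i + (norm (z' i - y))\<^sup>2 / (2 * \<nu>)))"
      unfolding sum_distrib_left sum.distrib[symmetric] e_def
      by (intro sum.cong refl) (simp add: algebra_simps add_divide_distrib)
    also have "\<dots> \<le> a * r + b * s"
      using z(3) z'(3) ab by (intro add_mono mult_left_mono) auto
    finally show ?thesis .
  qed
  ultimately have "(a *\<^sub>R x + b *\<^sub>R y, a * r + b * s) \<in> averaged_epigraph I \<nu> f w"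
    by (rule averaged_epigraphI)
  then show "a *\<^sub>R P + b *\<^sub>R Q \<in> averaged_epigraph I \<nu> f w"
    by (simp add: PQ)
qed

text \<open>Nonnegativity of the \<open>f i\<close> makes every summand nonnegative, so that along a convergent
  sequence of pairs \<open>(x, r)\<close> the points \<open>(z i, c i)\<close> stay bounded and a subsequence converges.\<close>

lemma closed_averaged_epigraph:
  fixes f :: "'i \<Rightarrow> 'a::euclidean_space \<Rightarrow> ereal"
  assumes fin: "finite I" and \<nu>: "0 < \<nu>" and w: "\<And>i. i \<in> I \<Longrightarrow> 0 < w i"
    and nonneg: "\<And>i x. i \<in> I \<Longrightarrow> 0 \<le> f i x"
    and cl: "\<And>i. i \<in> I \<Longrightarrow> closed {(x, r). f i x \<le> ereal r}"
  shows "closed (averaged_epigraph I \<nu> f w)"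
  unfolding closed_sequential_limits
proof (intro allI impI, elim conjE)
  fix P :: "nat \<Rightarrow> 'a \<times> real" and l
  assume P: "\<forall>k. P k \<in> averaged_epigraph I \<nu> f w" and lim: "P \<longlonglongrightarrow> l"
  define X where "X k = fst (P k)" for k
  define R where "R k = snd (P k)" for k
  obtain x r where l: "l = (x, r)" by (cases l)
  have X: "X \<longlonglongrightarrow> x" and R: "R \<longlonglongrightarrow> r"
    using tendsto_fst[OF lim] tendsto_snd[OF lim] l unfolding X_def R_def by simp_all
  have "\<forall>k. \<exists>g. (\<forall>i\<in>I. f i (fst (g i)) \<le> ereal (snd (g i))) \<and> (\<Sum>i\<in>I. w i *\<^sub>R fst (g i)) = X k
      \<and> (\<Sum>i\<in>I. w i * (snd (g i) + (norm (fst (g i) - X k))\<^sup>2 / (2 * \<nu>))) \<le> R k"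
    (is "\<forall>k. ?ex k")
  proof
    fix k
    have "(X k, R k) \<in> averaged_epigraph I \<nu> f w" using P by (simp add: X_def R_def)
    then show "?ex k"
    proof (rule averaged_epigraphE)
      fix z c
      assume "\<And>i. i \<in> I \<Longrightarrow> f i (z i) \<le> ereal (c i)" "(\<Sum>i\<in>I. w i *\<^sub>R z i) = X k"
        "(\<Sum>i\<in>I. w i * (c i + (norm (z i - X k))\<^sup>2 / (2 * \<nu>))) \<le> R k"
      then show "?ex k" by (intro exI[of _ "\<lambda>i. (z i, c i)"]) simp
    qed
  qed
  from choice[OF this] obtain g where
      gf: "\<And>k i. i \<in> I \<Longrightarrow> f i (fst (g k i)) \<le> ereal (snd (g k i))"
    and gX: "\<And>k. (\<Sum>i\<in>I. w i *\<^sub>R fst (g k i)) = X k"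
    and gR: "\<And>k. (\<Sum>i\<in>I. w i * (snd (g k i) + (norm (fst (g k i) - X k))\<^sup>2 / (2 * \<nu>))) \<le> R k"
    by blast
  have c0: "0 \<le> snd (g k i)" if "i \<in> I" for k i
    using order_trans[OF nonneg[OF that] gf[OF that]] by simp
  obtain M where M: "\<And>k. \<bar>R k\<bar> \<le> M"
    using convergent_imp_Bseq[of R] R unfolding convergent_def Bseq_def by auto
  obtain N where N: "\<And>k. norm (X k) \<le> N"
    using convergent_imp_Bseq[of X] X unfolding convergent_def Bseq_def by auto
  have bdd: "bounded (range (\<lambda>k. g k i))" if i: "i \<in> I" for i
  proof -
    have summand: "snd (g k i) + (norm (fst (g k i) - X k))\<^sup>2 / (2 * \<nu>) \<le> M / w i" for k
    proof -
      have "w i * (snd (g k i) + (norm (fst (g k i) - X k))\<^sup>2 / (2 * \<nu>))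
          \<le> (\<Sum>i\<in>I. w i * (snd (g k i) + (norm (fst (g k i) - X k))\<^sup>2 / (2 * \<nu>)))"
        using fin i c0 \<nu> w by (intro member_le_sum) (auto simp: less_imp_le)
      also have "\<dots> \<le> M" using gR[of k] M[of k] by simp
      finally show ?thesis using w[OF i] by (simp add: pos_le_divide_eq mult.commute)
    qed
    have sq: "0 \<le> (norm (fst (g k i) - X k))\<^sup>2 / (2 * \<nu>)" for k
      using \<nu> by simp
    have c: "norm (snd (g k i)) \<le> M / w i" for k
      using summand[of k] c0[OF i, of k] sq[of k] by simp
    have z: "norm (fst (g k i)) \<le> N + sqrt (2 * \<nu> * (M / w i))" for k
    proof -
      have "(norm (fst (g k i) - X k))\<^sup>2 / (2 * \<nu>) \<le> M / w i"
        using summand[of k] c0[OF i, of k] by simp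
      then have "(norm (fst (g k i) - X k))\<^sup>2 \<le> 2 * \<nu> * (M / w i)"
        using \<nu> by (simp add: pos_divide_le_eq mult.commute)
      then have "norm (fst (g k i) - X k) \<le> sqrt (2 * \<nu> * (M / w i))"
        by (rule real_le_rsqrt)
      then show ?thesis
        using N[of k] norm_triangle_ineq[of "X k" "fst (g k i) - X k"] by simp
    qed
    have "norm (g k i) \<le> N + sqrt (2 * \<nu> * (M / w i)) + M / w i" for k
      using norm_Pair_le[of "fst (g k i)" "snd (g k i)"] z[of k] c[of k] by simp
    then show ?thesis by (auto intro!: boundedI)
  qed
  have "\<exists>h \<rho>. strict_mono \<rho>
      \<and> (\<forall>e>0. eventually (\<lambda>k. \<forall>i\<in>I. dist (g (\<rho> k) i) (h i) < e) sequentially)"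
    using compact_lemma_general[where f = g and basis = I and proj = "\<lambda>p i. p i"
        and unproj = "\<lambda>p. p"] fin bdd
    by (simp add: image_image)
  then obtain h and \<rho> :: "nat \<Rightarrow> nat" where \<rho>: "strict_mono \<rho>"
    and h: "\<And>e. e > 0 \<Longrightarrow> eventually (\<lambda>k. \<forall>i\<in>I. dist (g (\<rho> k) i) (h i) < e) sequentially"
    by blast
  have glim: "(\<lambda>k. g (\<rho> k) i) \<longlonglongrightarrow> h i" if "i \<in> I" for i
    by (rule tendstoI) (rule eventually_mono[OF h], use that in auto)
  have zlim: "(\<lambda>k. fst (g (\<rho> k) i)) \<longlonglongrightarrow> fst (h i)"
    and clim: "(\<lambda>k. snd (g (\<rho> k) i)) \<longlonglongrightarrow> snd (h i)" if "i \<in> I" for i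
    using glim[OF that] by (auto intro: tendsto_fst tendsto_snd)
  have X': "(\<lambda>k. X (\<rho> k)) \<longlonglongrightarrow> x" and R': "(\<lambda>k. R (\<rho> k)) \<longlonglongrightarrow> r"
    using LIMSEQ_subseq_LIMSEQ[OF X \<rho>] LIMSEQ_subseq_LIMSEQ[OF R \<rho>] by (simp_all add: o_def)
  have "f i (fst (h i)) \<le> ereal (snd (h i))" if i: "i \<in> I" for i
  proof -
    have "h i \<in> {(x, r). f i x \<le> ereal r}"
      using closed_sequentially[OF cl[OF i] _ glim[OF i]] gf[OF i] by (simp add: split_beta)
    then show ?thesis by (simp add: split_beta)
  qed
  moreover have "(\<Sum>i\<in>I. w i *\<^sub>R fst (h i)) = x"
  proof -
    have "(\<lambda>k. \<Sum>i\<in>I. w i *\<^sub>R fst (g (\<rho> k) i)) \<longlonglongrightarrow> (\<Sum>i\<in>I. w i *\<^sub>R fst (h i))"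
      by (intro tendsto_intros zlim)
    then show ?thesis using X' LIMSEQ_unique by (simp add: gX)
  qed
  moreover have "(\<Sum>i\<in>I. w i * (snd (h i) + (norm (fst (h i) - x))\<^sup>2 / (2 * \<nu>))) \<le> r"
  proof (rule LIMSEQ_le[OF _ R'])
    show "(\<lambda>k. \<Sum>i\<in>I. w i * (snd (g (\<rho> k) i) + (norm (fst (g (\<rho> k) i) - X (\<rho> k)))\<^sup>2 / (2 * \<nu>)))
        \<longlonglongrightarrow> (\<Sum>i\<in>I. w i * (snd (h i) + (norm (fst (h i) - x))\<^sup>2 / (2 * \<nu>)))"
      using \<nu> by (intro tendsto_intros zlim clim X') auto
  qed (use gR in auto)
  ultimately show "l \<in> averaged_epigraph I \<nu> f w"
    unfolding l by (rule averaged_epigraphI)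
qed

text \<open>The infimum in the definition of the proximal average is attained, so membership in
  \<^const>\<open>averaged_epigraph\<close> is exact and not only up to an arbitrarily small error.\<close>

lemma proximal_average_le_iff:
  fixes f :: "nat \<Rightarrow> 'a::euclidean_space \<Rightarrow> ereal"
  assumes \<nu>: "0 < \<nu>" and w: "\<And>i. i \<in> {1..n} \<Longrightarrow> 0 < w i" and w1: "(\<Sum>i\<in>{1..n}. w i) = 1"
    and nonneg: "\<And>i x. i \<in> {1..n} \<Longrightarrow> 0 \<le> f i x"
    and cl: "\<And>i. i \<in> {1..n} \<Longrightarrow> closed {(x, r). f i x \<le> ereal r}"
  shows "proximal_average n \<nu> f w x \<le> ereal r \<longleftrightarrow> (x, r) \<in> averaged_epigraph {1..n} \<nu> f w"
proof -
  define T where "T y = (\<Sum>i\<in>{1..n}. ereal (w i) *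
      (ereal \<nu> * f i (y i /\<^sub>R w i) + ereal (1/2 * (norm (y i /\<^sub>R w i))\<^sup>2)))" for y
  define J where "J = (INF y \<in> {y. (\<Sum>i\<in>{1..n}. y i) = x}. T y)"
  have pa: "proximal_average n \<nu> f w x \<le> ereal s \<longleftrightarrow> J \<le> ereal (\<nu> * s + 1/2 * (norm x)\<^sup>2)" for s
  proof -
    have "proximal_average n \<nu> f w x = ereal (1 / \<nu>) * (ereal (- (1/2) * (norm x)\<^sup>2) + J)"
      unfolding proximal_average_def J_def T_def by simp
    then show ?thesis
      using \<nu> by (cases J) (auto simp: field_simps)
  qed
  \<comment> \<open>\<open>\<nu> * value + \<parallel>x\<parallel>\<^sup>2 / 2\<close> relates the variance form to the form in the definition.\<close>
  have quad: "(\<Sum>i\<in>{1..n}. w i * (\<nu> * c i + 1/2 * (norm (z i))\<^sup>2))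
      = \<nu> * (\<Sum>i\<in>{1..n}. w i * (c i + (norm (z i - x))\<^sup>2 / (2 * \<nu>))) + 1/2 * (norm x)\<^sup>2"
    if "(\<Sum>i\<in>{1..n}. w i *\<^sub>R z i) = x" for z :: "nat \<Rightarrow> 'a" and c :: "nat \<Rightarrow> real"
  proof -
    have "\<nu> * (\<Sum>i\<in>{1..n}. w i * (c i + (norm (z i - x))\<^sup>2 / (2 * \<nu>)))
        = \<nu> * (\<Sum>i\<in>{1..n}. w i * c i) + 1/2 * (\<Sum>i\<in>{1..n}. w i * (norm (z i - x))\<^sup>2)"
      unfolding sum_distrib_left sum.distrib[symmetric]
      using \<nu> by (intro sum.cong refl) (simp add: field_simps)
    also have "\<dots> = \<nu> * (\<Sum>i\<in>{1..n}. w i * c i) + 1/2 * (\<Sum>i\<in>{1..n}. w i * (norm (z i))\<^sup>2)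
        - 1/2 * (norm x)\<^sup>2"
      using weighted_variance_eq[OF w1 that] by (simp add: algebra_simps)
    also have "\<nu> * (\<Sum>i\<in>{1..n}. w i * c i) + 1/2 * (\<Sum>i\<in>{1..n}. w i * (norm (z i))\<^sup>2)
        = (\<Sum>i\<in>{1..n}. w i * (\<nu> * c i + 1/2 * (norm (z i))\<^sup>2))"
      unfolding sum_distrib_left sum.distrib[symmetric]
      by (intro sum.cong refl) (simp add: algebra_simps)
    finally show ?thesis by simp
  qed
  have almost: "(x, s) \<in> averaged_epigraph {1..n} \<nu> f w" if "J < ereal (\<nu> * s + 1/2 * (norm x)\<^sup>2)" for s
  proof -
    have "\<exists>y\<in>{y. (\<Sum>i\<in>{1..n}. y i) = x}. T y < ereal (\<nu> * s + 1/2 * (norm x)\<^sup>2)"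
      using that unfolding J_def INF_less_iff .
    then obtain y where y: "(\<Sum>i\<in>{1..n}. y i) = x" and T: "T y < ereal (\<nu> * s + 1/2 * (norm x)\<^sup>2)"
      by blast
    define z where "z i = y i /\<^sub>R w i" for i
    have sumz: "(\<Sum>i\<in>{1..n}. w i *\<^sub>R z i) = x"
      unfolding y[symmetric] by (intro sum.cong refl) (use w in \<open>force simp: z_def\<close>)
    have "f i (z i) \<noteq> \<infinity>" if i: "i \<in> {1..n}" for i
    proof
      assume "f i (z i) = \<infinity>"
      then have "ereal (w i) * (ereal \<nu> * f i (y i /\<^sub>R w i) + ereal (1/2 * (norm (y i /\<^sub>R w i))\<^sup>2)) = \<infinity>"
        using w[OF i] \<nu> by (simp add: z_def)
      then have "T y = \<infinity>" unfolding T_def sum_Pinfty using i by blast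
      with T show False by simp
    qed
    then have "\<exists>c. f i (z i) = ereal c" if "i \<in> {1..n}" for i
      using nonneg[OF that, of "z i"] that by (cases "f i (z i)") auto
    then obtain c where c: "\<And>i. i \<in> {1..n} \<Longrightarrow> f i (z i) = ereal (c i)"
      by metis
    have "T y = (\<Sum>i\<in>{1..n}. ereal (w i * (\<nu> * c i + 1/2 * (norm (z i))\<^sup>2)))"
      unfolding T_def z_def[symmetric] by (intro sum.cong refl) (simp add: c)
    then have "(\<Sum>i\<in>{1..n}. w i * (\<nu> * c i + 1/2 * (norm (z i))\<^sup>2)) < \<nu> * s + 1/2 * (norm x)\<^sup>2"
      using T by simp
    then have "(\<Sum>i\<in>{1..n}. w i * (c i + (norm (z i - x))\<^sup>2 / (2 * \<nu>))) \<le> s"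
      unfolding quad[OF sumz] using \<nu> by simp
    then show ?thesis
      using sumz c by (intro averaged_epigraphI) auto
  qed
  show ?thesis
  proof
    assume "proximal_average n \<nu> f w x \<le> ereal r"
    then have J: "J \<le> ereal (\<nu> * r + 1/2 * (norm x)\<^sup>2)" by (simp add: pa)
    have mem: "(x, r + inverse (real (Suc k))) \<in> averaged_epigraph {1..n} \<nu> f w" for k
    proof (rule almost, rule le_less_trans[OF J])
      show "ereal (\<nu> * r + 1/2 * (norm x)\<^sup>2)
          < ereal (\<nu> * (r + inverse (real (Suc k))) + 1/2 * (norm x)\<^sup>2)"
        using \<nu> by simp
    qed
    have lim: "(\<lambda>k. (x, r + inverse (real (Suc k)))) \<longlonglongrightarrow> (x, r)"
      by (intro tendsto_Pair tendsto_const LIMSEQ_inverse_real_of_nat_add)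
    have "closed (averaged_epigraph {1..n} \<nu> f w)"
      using \<nu> w nonneg cl by (intro closed_averaged_epigraph) auto
    then show "(x, r) \<in> averaged_epigraph {1..n} \<nu> f w"
      by (rule closed_sequentially[OF _ mem lim])
  next
    assume "(x, r) \<in> averaged_epigraph {1..n} \<nu> f w"
    then obtain z c where z: "\<And>i. i \<in> {1..n} \<Longrightarrow> f i (z i) \<le> ereal (c i)"
        "(\<Sum>i\<in>{1..n}. w i *\<^sub>R z i) = x"
        "(\<Sum>i\<in>{1..n}. w i * (c i + (norm (z i - x))\<^sup>2 / (2 * \<nu>))) \<le> r"
      by (rule averaged_epigraphE) (rule that)
    have "J \<le> T (\<lambda>i. w i *\<^sub>R z i)"
      unfolding J_def using z(2) by (intro INF_lower) auto
    also have "\<dots> \<le> (\<Sum>i\<in>{1..n}. ereal (w i * (\<nu> * c i + 1/2 * (norm (z i))\<^sup>2)))"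
      unfolding T_def
    proof (rule sum_mono)
      fix i assume i: "i \<in> {1..n}"
      have "ereal (w i) * (ereal \<nu> * f i (z i) + ereal (1/2 * (norm (z i))\<^sup>2))
          \<le> ereal (w i) * (ereal \<nu> * ereal (c i) + ereal (1/2 * (norm (z i))\<^sup>2))"
        using z(1)[OF i] w[OF i] \<nu> by (intro ereal_mult_left_mono add_right_mono) auto
      moreover have "(w i *\<^sub>R z i) /\<^sub>R w i = z i" using w[OF i] by simp
      ultimately show "ereal (w i) * (ereal \<nu> * f i ((w i *\<^sub>R z i) /\<^sub>R w i)
            + ereal (1/2 * (norm ((w i *\<^sub>R z i) /\<^sub>R w i))\<^sup>2))
          \<le> ereal (w i * (\<nu> * c i + 1/2 * (norm (z i))\<^sup>2))"
        by simp
    qed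
    also have "\<dots> \<le> ereal (\<nu> * r + 1/2 * (norm x)\<^sup>2)"
      unfolding sum_ereal quad[OF z(2)] using z(3) \<nu> by simp
    finally show "proximal_average n \<nu> f w x \<le> ereal r" by (simp add: pa)
  qed
qed

section \<open>The resolvent average\<close>

lemma in_sum_sets_iff:
  fixes S :: "'i \<Rightarrow> 'a::comm_monoid_add set"
  assumes "finite I"
  shows "x \<in> (\<Sum>i\<in>I. S i) \<longleftrightarrow> (\<exists>s. (\<forall>i\<in>I. s i \<in> S i) \<and> x = (\<Sum>i\<in>I. s i))"
  using assms by (auto simp: set_sum_alt)

lemma resolvent_averageE:
  assumes "u \<in> resolvent_average n \<mu> A w x"
  obtains p where "x = (\<Sum>i\<in>{1..n}. w i *\<^sub>R p i)"
    "\<And>i. i \<in> {1..n} \<Longrightarrow> u + inverse \<mu> *\<^sub>R (x - p i) \<in> A i (p i)"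
proof -
  have "u + inverse \<mu> *\<^sub>R x \<in> sv_inverse (sv_sum (\<lambda>i. sv_scale (w i)
      (sv_inverse (sv_add (A i) (sv_scale (inverse \<mu>) sv_id)))) {1..n}) x"
    using assms
    by (auto simp: resolvent_average_def sv_add_def[of "sv_inverse _"] sv_scale_def[of "- _"]
        sv_id_def elim!: set_plus_elim)
  then have "x \<in> (\<Sum>i\<in>{1..n}. sv_scale (w i)
      (sv_inverse (sv_add (A i) (sv_scale (inverse \<mu>) sv_id))) (u + inverse \<mu> *\<^sub>R x))"
    by (simp add: sv_inverse_def[of "sv_sum _ _"] sv_sum_def)
  then obtain s where s: "\<And>i. i \<in> {1..n} \<Longrightarrow> s i \<in> sv_scale (w i)
      (sv_inverse (sv_add (A i) (sv_scale (inverse \<mu>) sv_id))) (u + inverse \<mu> *\<^sub>R x)"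
    and x: "x = (\<Sum>i\<in>{1..n}. s i)"
    unfolding in_sum_sets_iff[OF finite_atLeastAtMost] by blast
  have "\<exists>p. s i = w i *\<^sub>R p \<and> u + inverse \<mu> *\<^sub>R (x - p) \<in> A i p" if i: "i \<in> {1..n}" for i
  proof -
    obtain p where p: "s i = w i *\<^sub>R p" "u + inverse \<mu> *\<^sub>R x \<in> A i p + {inverse \<mu> *\<^sub>R p}"
      using s[OF i] by (auto simp: sv_scale_def sv_inverse_def sv_add_def sv_id_def)
    then obtain b where "b \<in> A i p" "u + inverse \<mu> *\<^sub>R x = b + inverse \<mu> *\<^sub>R p"
      by (auto elim!: set_plus_elim)
    then have "u + inverse \<mu> *\<^sub>R (x - p) \<in> A i p"
      by (simp add: scaleR_diff_right add_diff_eq)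
    with p(1) show ?thesis by blast
  qed
  then obtain p where "\<And>i. i \<in> {1..n} \<Longrightarrow> s i = w i *\<^sub>R p i"
      "\<And>i. i \<in> {1..n} \<Longrightarrow> u + inverse \<mu> *\<^sub>R (x - p i) \<in> A i (p i)"
    by metis
  with x that show thesis by (metis (no_types, lifting) sum.cong)
qed

text \<open>The monotonicity inequality in the form of epigraph membership. The witnesses are the distances
  between the points \<open>p i\<close> and \<open>q i\<close> at which \<open>x\<close> and \<open>y\<close> decompose, shrunk by a common factor so
  that they average to \<open>\<parallel>x - y\<parallel>\<close>.\<close>

lemma resolvent_average_modulus:
  fixes A :: "nat \<Rightarrow> 'a::real_inner sv_op"
  assumes \<mu>: "0 < \<mu>" and w: "\<And>i. i \<in> {1..n} \<Longrightarrow> 0 < w i" and w1: "(\<Sum>i\<in>{1..n}. w i) = 1"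
    and mono: "\<And>i. i \<in> {1..n} \<Longrightarrow> monotone_with_modulus (A i) (\<phi> i)"
    and \<phi>_mono: "\<And>i s t. i \<in> {1..n} \<Longrightarrow> 0 \<le> s \<Longrightarrow> s \<le> t \<Longrightarrow> \<phi> i s \<le> \<phi> i t"
    and u: "u \<in> resolvent_average n \<mu> A w x" and v: "v \<in> resolvent_average n \<mu> A w y"
  shows "(norm (x - y), (u - v) \<bullet> (x - y))
    \<in> averaged_epigraph {1..n} (\<mu> / 2) (\<lambda>i. symmetric_extension (\<phi> i)) w"
proof -
  obtain p where p: "x = (\<Sum>i\<in>{1..n}. w i *\<^sub>R p i)"
      "\<And>i. i \<in> {1..n} \<Longrightarrow> u + inverse \<mu> *\<^sub>R (x - p i) \<in> A i (p i)"
    using resolvent_averageE[OF u] by metis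
  obtain q where q: "y = (\<Sum>i\<in>{1..n}. w i *\<^sub>R q i)"
      "\<And>i. i \<in> {1..n} \<Longrightarrow> v + inverse \<mu> *\<^sub>R (y - q i) \<in> A i (q i)"
    using resolvent_averageE[OF v] by metis
  define e where "e i = p i - q i" for i
  define t where "t = norm (x - y)"
  define c where "c i = (u - v) \<bullet> e i + ((x - y) \<bullet> e i - (norm (e i))\<^sup>2) / \<mu>" for i
  have sume: "(\<Sum>i\<in>{1..n}. w i *\<^sub>R e i) = x - y"
    by (simp add: p(1) q(1) e_def scaleR_diff_right sum_subtractf)
  have \<phi>_le: "\<phi> i (norm (e i)) \<le> ereal (c i)" if i: "i \<in> {1..n}" for i
  proof -
    have "\<phi> i (norm (p i - q i)) \<le> ereal (((u + inverse \<mu> *\<^sub>R (x - p i))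
        - (v + inverse \<mu> *\<^sub>R (y - q i))) \<bullet> (p i - q i))"
      using mono[OF i] p(2)[OF i] q(2)[OF i] unfolding monotone_with_modulus_def by blast
    also have "(u + inverse \<mu> *\<^sub>R (x - p i)) - (v + inverse \<mu> *\<^sub>R (y - q i))
        = (u - v) + inverse \<mu> *\<^sub>R ((x - y) - e i)"
      by (simp add: e_def algebra_simps)
    also have "\<dots> \<bullet> (p i - q i) = c i"
      by (simp add: c_def e_def[symmetric] inner_add_left inner_diff_left power2_norm_eq_inner
          divide_inverse mult.commute)
    finally show ?thesis by (simp add: e_def)
  qed
  have sumc: "(\<Sum>i\<in>{1..n}. w i * c i)
      = (u - v) \<bullet> (x - y) + (t\<^sup>2 - (\<Sum>i\<in>{1..n}. w i * (norm (e i))\<^sup>2)) / \<mu>"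
  proof -
    have "(\<Sum>i\<in>{1..n}. w i * c i) = (\<Sum>i\<in>{1..n}. (u - v) \<bullet> (w i *\<^sub>R e i)
        + ((x - y) \<bullet> (w i *\<^sub>R e i) - w i * (norm (e i))\<^sup>2) / \<mu>)"
      by (intro sum.cong refl) (simp add: c_def algebra_simps)
    also have "\<dots> = (u - v) \<bullet> (\<Sum>i\<in>{1..n}. w i *\<^sub>R e i) + ((x - y) \<bullet> (\<Sum>i\<in>{1..n}. w i *\<^sub>R e i)
        - (\<Sum>i\<in>{1..n}. w i * (norm (e i))\<^sup>2)) / \<mu>"
      by (simp add: sum.distrib sum_subtractf inner_sum_right flip: sum_divide_distrib)
    finally show ?thesis
      unfolding sume by (simp only: t_def power2_norm_eq_inner[symmetric])
  qed
  define D where "D = (\<Sum>i\<in>{1..n}. w i * norm (e i))"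
  have "t \<le> (\<Sum>i\<in>{1..n}. norm (w i *\<^sub>R e i))"
    unfolding t_def sume[symmetric] by (rule norm_sum)
  also have "\<dots> = D"
    unfolding D_def by (intro sum.cong refl) (use w in \<open>auto simp: abs_of_pos\<close>)
  finally have tD: "t \<le> D" .
  \<comment> \<open>If \<open>D = 0\<close> then \<open>t = 0\<close>, and division by zero gives \<open>s = 0\<close>, as wanted.\<close>
  define s where "s = t / D"
  have t0: "0 \<le> t" by (simp add: t_def)
  have s: "0 \<le> s" "s \<le> 1" and sD: "s * D = t"
    using t0 tD by (auto simp: s_def divide_simps)
  define z where "z i = s * norm (e i)" for i
  have z: "0 \<le> z i" "z i \<le> norm (e i)" for i
    using s by (auto simp: z_def mult_left_le_one_le)
  show ?thesis
    unfolding t_def[symmetric]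
  proof (rule averaged_epigraphI)
    fix i assume i: "i \<in> {1..n}"
    have "\<phi> i (z i) \<le> \<phi> i (norm (e i))" using \<phi>_mono[OF i z] .
    then show "symmetric_extension (\<phi> i) (z i) \<le> ereal (c i)"
      using \<phi>_le[OF i] z(1)[of i] by (simp add: symmetric_extension_def)
  next
    show sumz: "(\<Sum>i\<in>{1..n}. w i *\<^sub>R z i) = t"
      using sD by (simp add: z_def D_def sum_distrib_left mult.left_commute)
    have "(\<Sum>i\<in>{1..n}. w i * (c i + (norm (z i - t))\<^sup>2 / (2 * (\<mu> / 2))))
        = (\<Sum>i\<in>{1..n}. w i * c i) + (\<Sum>i\<in>{1..n}. w i * (norm (z i - t))\<^sup>2) / \<mu>"
      by (simp add: distrib_left sum.distrib sum_divide_distrib)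
    also have "(\<Sum>i\<in>{1..n}. w i * (norm (z i - t))\<^sup>2) = (\<Sum>i\<in>{1..n}. w i * (z i)\<^sup>2) - t\<^sup>2"
      using weighted_variance_eq[OF w1 sumz] by simp
    also have "(\<Sum>i\<in>{1..n}. w i * c i) + ((\<Sum>i\<in>{1..n}. w i * (z i)\<^sup>2) - t\<^sup>2) / \<mu>
        \<le> (u - v) \<bullet> (x - y)"
    proof -
      have "(\<Sum>i\<in>{1..n}. w i * (z i)\<^sup>2) \<le> (\<Sum>i\<in>{1..n}. w i * (norm (e i))\<^sup>2)"
        using w z by (intro sum_mono mult_left_mono power_mono) (auto simp: less_imp_le)
      then have "((\<Sum>i\<in>{1..n}. w i * (z i)\<^sup>2) - t\<^sup>2) / \<mu>
          \<le> ((\<Sum>i\<in>{1..n}. w i * (norm (e i))\<^sup>2) - t\<^sup>2) / \<mu>"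
        using \<mu> by (intro divide_right_mono) auto
      then show ?thesis unfolding sumc diff_divide_distrib by linarith
    qed
    finally show "(\<Sum>i\<in>{1..n}. w i * (c i + (norm (z i - t))\<^sup>2 / (2 * (\<mu> / 2))))
        \<le> (u - v) \<bullet> (x - y)" .
  qed
qed

theorem theorem3p12:
  fixes A :: "nat \<Rightarrow> 'a::{real_inner, complete_space} \<Rightarrow> 'a set"
    and \<phi> :: "nat \<Rightarrow> real \<Rightarrow> ereal"
    and w :: "nat \<Rightarrow> real"
    and \<mu> :: real
    and n :: nat
  defines "\<psi> \<equiv> proximal_average n (\<mu> / 2) (\<lambda>i. symmetric_extension (\<phi> i)) w"
  assumes "0 < \<mu>"
    and "1 \<le> n"
    and "\<And>i. i \<in> {1..n} \<Longrightarrow> 0 < w i"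
    and "(\<Sum>i\<in>{1..n}. w i) = 1"
    and "\<And>i. i \<in> {1..n} \<Longrightarrow> maximally_monotone (A i)"
    and "\<And>i. i \<in> {1..n} \<Longrightarrow> monotone_with_modulus (A i) (\<phi> i)"
    and "\<And>i. i \<in> {1..n} \<Longrightarrow> lsc_on {0..} (\<phi> i)"
    and "\<And>i. i \<in> {1..n} \<Longrightarrow> ereal_convex_on {0..} (\<phi> i)"
  shows "monotone_with_modulus (resolvent_average n \<mu> A w) \<psi>
    \<and> lsc_on UNIV \<psi>
    \<and> ereal_convex_on UNIV \<psi>
    \<and> ((\<exists>i0\<in>{1..n}. uniformly_monotone (A i0) (\<phi> i0))
         \<longrightarrow> uniformly_monotone (resolvent_average n \<mu> A w) \<psi>)"
proof -
  define f where "f i = symmetric_extension (\<phi> i)" for i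
  define E where "E = averaged_epigraph {1..n} (\<mu> / 2) f w"
  note w = assms(4) and w1 = assms(5)
  have \<nu>: "0 < \<mu> / 2" using assms(2) by simp
  have mod: "modulus (\<phi> i)" if "i \<in> {1..n}" for i
    using assms(7)[OF that] by (simp add: monotone_with_modulus_def)
  have \<phi>0: "\<phi> i 0 = 0" if "i \<in> {1..n}" for i
    using modulus_at_0[OF assms(6)[OF that] assms(7)[OF that]] .
  have nonneg: "0 \<le> f i t" if "i \<in> {1..n}" for i t
    using mod[OF that] by (simp add: f_def symmetric_extension_def modulus_def)
  have cl: "closed {(t, c). f i t \<le> ereal c}" if "i \<in> {1..n}" for i
    unfolding f_def using closed_epigraph_symmetric_extension[OF assms(8)[OF that]] .
  have conv: "ereal_convex_on UNIV (f i)" if "i \<in> {1..n}" for i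
    unfolding f_def by (rule convex_symmetric_extension[OF mod[OF that] \<phi>0[OF that] assms(9)[OF that]])
  have \<psi>_le: "\<psi> t \<le> ereal r \<longleftrightarrow> (t, r) \<in> E" for t r
    unfolding \<psi>_def E_def f_def[symmetric]
    by (rule proximal_average_le_iff[OF \<nu> w w1 nonneg cl])
  then have epi: "{(t, r). t \<in> UNIV \<and> \<psi> t \<le> ereal r} = E" by auto
  have lsc: "lsc_on UNIV \<psi>"
    unfolding lsc_on_iff_closed_epigraph[OF closed_UNIV] epi E_def
    by (rule closed_averaged_epigraph[OF finite_atLeastAtMost \<nu> w nonneg cl])
  have convex: "ereal_convex_on UNIV \<psi>"
    unfolding ereal_convex_on_def epi E_def
    by (rule convex_averaged_epigraph[OF \<nu> less_imp_le[OF w] conv])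
  \<comment> \<open>A nonpositive bound forces the function values and the variance in the decomposition to vanish.\<close>
  have nonpos_bound: "(\<forall>i\<in>{1..n}. f i t = 0) \<and> r = 0" if tr: "(t, r) \<in> E" "r \<le> 0" for t r
  proof -
    obtain z c where z: "\<And>i. i \<in> {1..n} \<Longrightarrow> f i (z i) \<le> ereal (c i)"
        and le: "(\<Sum>i\<in>{1..n}. w i * (c i + (norm (z i - t))\<^sup>2 / (2 * (\<mu> / 2)))) \<le> r"
      using tr(1) unfolding E_def by (rule averaged_epigraphE) (rule that)
    have c: "0 \<le> c i" if "i \<in> {1..n}" for i
      using order_trans[OF nonneg[OF that] z[OF that]] by simp
    have summand: "0 \<le> w i * (c i + (norm (z i - t))\<^sup>2 / (2 * (\<mu> / 2)))" if "i \<in> {1..n}" for i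
      using c[OF that] w[OF that] assms(2) by simp
    have zero: "(\<Sum>i\<in>{1..n}. w i * (c i + (norm (z i - t))\<^sup>2 / (2 * (\<mu> / 2)))) = 0"
      by (rule antisym[OF order_trans[OF le tr(2)] sum_nonneg[OF summand]])
    have "f i t = 0" if i: "i \<in> {1..n}" for i
    proof -
      have "w i * (c i + (norm (z i - t))\<^sup>2 / (2 * (\<mu> / 2))) = 0"
        using zero summand i by (subst (asm) sum_nonneg_eq_0_iff) auto
      then have "c i + (norm (z i - t))\<^sup>2 / \<mu> = 0"
        using w[OF i] by simp
      moreover have "0 \<le> (norm (z i - t))\<^sup>2 / \<mu>"
        using assms(2) by simp
      ultimately have "c i = 0" "(norm (z i - t))\<^sup>2 / \<mu> = 0"
        using c[OF i] by linarith+
      then have "f i t \<le> 0"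
        using z[OF i] assms(2) by (simp add: zero_ereal_def)
      then show ?thesis using nonneg[OF i, of t] by simp
    qed
    moreover have "r = 0" using le zero tr(2) by linarith
    ultimately show ?thesis by blast
  qed
  have \<psi>_nonneg: "0 \<le> \<psi> t" for t
  proof (rule ccontr)
    assume "\<not> 0 \<le> \<psi> t"
    then obtain r where "\<psi> t < ereal r" "ereal r < 0"
      using ereal_dense2 by (metis not_le)
    then have "(t, r) \<in> E" "r < 0" by (simp_all flip: \<psi>_le)
    then show False using nonpos_bound[of t r] by simp
  qed
  have monotone: "monotone_with_modulus (resolvent_average n \<mu> A w) \<psi>"
    unfolding monotone_with_modulus_def
  proof (intro conjI allI ballI)
    show "modulus \<psi>" by (simp add: modulus_def \<psi>_nonneg)
    fix x y u v
    assume uv: "u \<in> resolvent_average n \<mu> A w x" "v \<in> resolvent_average n \<mu> A w y"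
    show "\<psi> (norm (x - y)) \<le> ereal ((u - v) \<bullet> (x - y))"
      unfolding \<psi>_le E_def f_def
      using convex_modulus_mono[OF mod \<phi>0 assms(9)]
      by (intro resolvent_average_modulus[OF assms(2) w w1 assms(7) _ uv])
  qed
  have "uniformly_monotone (resolvent_average n \<mu> A w) \<psi>"
    if i0: "i0 \<in> {1..n}" "uniformly_monotone (A i0) (\<phi> i0)" for i0
    unfolding uniformly_monotone_def
  proof (intro conjI monotone allI impI iffI)
    fix t :: real assume t: "0 \<le> t" "\<psi> t = 0"
    then have "(t, 0) \<in> E" by (simp flip: \<psi>_le)
    then have "f i0 t = 0" using nonpos_bound i0(1) by blast
    then show "t = 0"
      using t(1) i0(2) by (simp add: f_def symmetric_extension_def uniformly_monotone_def)
  next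
    fix t :: real assume "t = 0"
    have "(0, 0) \<in> E"
      unfolding E_def
      by (rule averaged_epigraphI[where z = "\<lambda>_. 0" and c = "\<lambda>_. 0"])
        (auto simp: f_def symmetric_extension_def \<phi>0)
    then have "\<psi> 0 \<le> 0" by (simp add: zero_ereal_def flip: \<psi>_le)
    with \<psi>_nonneg[of 0] \<open>t = 0\<close> show "\<psi> t = 0" by simp
  qed
  with monotone lsc convex show ?thesis by blast
qed

end
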